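(* The following identities hold as identities between formal power series in $z$. (B) Let either $\theta\in[0,1]$ and $a\ge 0$, or $\theta\in[-1,0)$ and $a\in[-\theta,-\frac1\theta]$. Then $$\sum_{n=0}^\infty p_n^a(\theta)z^n=\frac{E\left(\theta,\frac{az}{1+a}\right)-E\left(\theta,\frac{-z}{1+a}\right)}{z\,E\left(\theta,\frac{-z}{1+a}\right)}.$$ (G) Let $\theta\in[-1,0)$ and $a\ge -1/\theta$. Then $$\sum_{n=0}^\infty p_n^a(\theta)z^n=\frac{\theta a+1}{\theta(1+a)}+\frac{E\left(\theta,\frac{-z}{\theta(1+a)}\right)-E\left(\theta,\frac{-z}{1+a}\right)}{z\,E\left(\theta,\frac{-z}{1+a}\right)}.$$ (Y) Let $\theta\in[-1,0)$ and $a\in[0,-\theta]$. Then $$\sum_{n=0}^\infty p_n^a(\theta)z^n=\frac1z\left(\frac{1}{\frac{E\left(\theta,\frac{az}{\theta(1+a)}\right)}{E\left(\theta,\frac{az}{1+a}\right)}-\frac{1+\frac a\theta}{1+a}\,z}-1\right).$$ (O) Let $\theta\in(0,1]$ and $-\theta\le a\le 0$ (with $a>-1$). Then, with $x_+:=\max(x,0)$, $$\sum_{n=0}^\infty p_n^a(\theta)z^n=\frac{\sum_{i=0}^\infty(-1)^i\frac{(\theta^i+a)_+^{i+1}}{(i+1)!\,\theta^{i(i+1)/2}(1+a)^{i+1}}z^i}{1-z\cdot\sum_{i=0}^\infty(-1)^i\frac{(\theta^i+a)_+^{i+1}}{(i+1)!\,\theta^{i(i+1)/2}(1+a)^{i+1}}z^i}.$$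 (W) Let $\theta\in[-1,1]$ and $-1<a\le\min(-\theta,0)$. Then $p_n^a(\theta)=1$ for all $n\ge 0$.
   Context: For $a\in(-1,\infty)$ and $\theta\in\mathbb R$, let $X_1,X_2,\ldots$ be i.i.d. random variables uniformly distributed on $[-a,1]$. Set $p_0^a(\theta):=1$ and, for $n\ge1$, $$p_n^a(\theta):=\mathbb P(X_2\ge\theta X_1,\,X_3\ge\theta X_2,\,\ldots,\,X_{n+1}\ge\theta X_n).$$ The deformed exponential function is $E(r,z):=\sum_{n=0}^\infty\frac{r^{n(n-1)/2}}{n!}z^n$ (for $|r|\le1$, with the convention $0^0=1$). *)

theory Defs
  imports "HOL-Probability.Probability" "HOL-Computational_Algebra.Formal_Power_Series"
begin

text \<open>The sequence of random variables is indexed from 1; \<open>X 0\<close> is never used.\<close>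

definition persistence_prob ::
  "'w measure \<Rightarrow> (nat \<Rightarrow> 'w \<Rightarrow> real) \<Rightarrow> real \<Rightarrow> nat \<Rightarrow> real" where
  "persistence_prob M X \<theta> n =
     (if n = 0 then 1
      else measure M {\<omega> \<in> space M. \<forall>i\<in>{1..n}. X (i + 1) \<omega> \<ge> \<theta> * X i \<omega>})"

text \<open>The formal series \<open>E(r, u)\<close>, for a formal power series \<open>u\<close> without constant term
  (composition of formal power series is meaningful only under this condition on \<open>u\<close>).\<close>

definition deformed_exp :: "real \<Rightarrow> real fps \<Rightarrow> real fps" where
  "deformed_exp r u = Abs_fps (\<lambda>n. r ^ (n * (n - 1) div 2) / fact n) oo u"

definition pos_part_series :: "real \<Rightarrow> real \<Rightarrow> real fps" where
  "pos_part_series \<theta> a = Abs_fps (\<lambda>i.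
     (- 1) ^ i * (max (\<theta> ^ i + a) 0) ^ (i + 1) /
       (fact (i + 1) * \<theta> ^ (i * (i + 1) div 2) * (1 + a) ^ (i + 1)))"

text \<open>Division of formal power series over a field discards negative powers. The
  quotients by \<open>fps_X\<close> below are genuine ones: every series divided by \<open>fps_X\<close>, or by
  \<open>fps_X\<close> times a unit, has constant term 0, and all other denominators have constant
  term 1. The following facts record this.\<close>

lemma deformed_exp_nth:
  "fps_nth (deformed_exp r (fps_const c * fps_X)) n = r ^ (n * (n - 1) div 2) / fact n * c ^ n"
  by (simp add: deformed_exp_def fps_compose_linear)

lemma deformed_exp_nth_0: "fps_nth (deformed_exp r (fps_const c * fps_X)) 0 = 1"
  by (simp add: deformed_exp_nth)

lemma fps_X_dvd_if_nth_0:
  fixes f :: "real fps"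
  assumes "fps_nth f 0 = 0"
  shows "fps_X dvd f"
proof (cases "f = 0")
  case False
  with assms have "subdegree f > 0"
    by (metis gr0I nth_subdegree_nonzero)
  with False show ?thesis
    by (simp add: fps_dvd_iff)
qed simp

lemma deformed_exp_quotient_exact:
  fixes r c d :: real
  defines "N \<equiv> deformed_exp r (fps_const c * fps_X) - deformed_exp r (fps_const d * fps_X)"
    and "D \<equiv> fps_X * deformed_exp r (fps_const d * fps_X)"
  shows "N / D * D = N"
proof -
  have u: "is_unit (deformed_exp r (fps_const d * fps_X))"
    by (simp add: deformed_exp_nth_0)
  have "fps_nth N 0 = 0"
    by (simp add: N_def deformed_exp_nth_0)
  then have "fps_X dvd N"
    by (rule fps_X_dvd_if_nth_0)
  then have "D dvd N"
    using u by (simp add: D_def mult_unit_dvd_iff)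
  then show ?thesis by simp
qed

lemma deformed_exp_reciprocal_exact:
  fixes r b c d :: real
  defines "D \<equiv> deformed_exp r (fps_const b * fps_X) / deformed_exp r (fps_const c * fps_X)
                 - fps_const d * fps_X"
  shows "1 / D * D = 1" and "(1 / D - 1) / fps_X * fps_X = 1 / D - 1"
proof -
  have "fps_nth D 0 = 1"
    by (simp add: D_def deformed_exp_nth_0 fps_divide_unit)
  then have u: "is_unit D" by simp
  then show "1 / D * D = 1" by simp
  have "fps_nth (1 / D - 1) 0 = 0"
    using \<open>fps_nth D 0 = 1\<close> by (simp add: fps_divide_unit)
  then have "fps_X dvd 1 / D - 1"
    by (rule fps_X_dvd_if_nth_0)
  then show "(1 / D - 1) / fps_X * fps_X = 1 / D - 1" by (rule dvd_div_mult_self)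
qed

end

theory Submission imports Defs begin

text \<open>
  Conditioning on the first variable shows that the persistence probabilities are values of
  functions \<open>K n\<close> given by \<open>K 0 u = 1\<close> and
  \<open>K (n + 1) u = 1 / (1 + a) * (integral of K n (\<theta> * y) for y from max u (-a) to 1)\<close>, namely
  \<open>p n = K (n + 1) (-a)\<close>. Here \<open>K n u\<close> is the probability that \<open>X 1 \<ge> u\<close>, \<open>X 2 \<ge> \<theta> * X 1\<close>, ...,
  \<open>X n \<ge> \<theta> * X (n - 1)\<close> (\<open>chain_prob\<close>, \<open>persistence_prob_eq_chain_prob\<close>). The rest of the proof
  is calculus with this recursion.

  Since the derivative of \<open>E(\<theta>, z)\<close> in \<open>z\<close> is \<open>E(\<theta>, \<theta> z)\<close>, for any power series \<open>C\<close> the coefficients in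
  \<open>z\<close> of \<open>C(z) * E(\<theta>, -u z / (1 + a))\<close> satisfy the differentiated recursion
  (\<open>has_integral_appell\<close>). Whenever multiplication by \<open>\<theta>\<close> preserves a suitable interval of levels
  \<open>u\<close>, the functions \<open>K n\<close> therefore have this form there, and the factor \<open>C\<close> is found from the boundary
  conditions. If the interval is \<open>{-a..1}\<close>, then \<open>K (n + 1) 1 = 0\<close> gives
  \<open>C = 1 / E(\<theta>, -z / (1 + a))\<close>. If \<open>\<theta> < 0\<close> and \<open>a\<close> is large, the interval is \<open>{\<theta>..1}\<close> with the same
  \<open>C\<close>, and for \<open>n > 0\<close> the integral defining \<open>K (n + 1) (-a)\<close> reduces to \<open>{1/\<theta>..1}\<close>. If \<open>\<theta> < 0\<close> and \<open>a\<close> is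
  small, the interval is \<open>{-a..-a/\<theta>}\<close>, and \<open>C\<close> solves a linear equation involving the unknown
  generating series itself.

  For \<open>\<theta> > 0\<close> and \<open>a < 0\<close> multiplication by \<open>\<theta>\<close> carries some levels in \<open>{-a..1}\<close> below \<open>-a\<close>, where
  \<open>K n\<close> is constant. Instead of following the pieces, the events are expanded by
  inclusion-exclusion into runs of reversed inequalities, whose probabilities are the explicit
  positive-part powers in the series; \<open>K (n + 1) 1 = 0\<close> is then a renewal equation
  (\<open>chain_prob_renewal\<close>). In the remaining range all inequalities hold almost surely.
\<close>

section \<open>Chain probabilities and their recursion\<close>

text \<open>The event that \<open>n\<close> consecutive coordinates of \<open>x\<close>, beginning with \<open>x m\<close>, form an admissible
  chain started at level \<open>u\<close>: \<open>u \<le> x m\<close>, \<open>\<theta> * x m \<le> x (m + 1)\<close>, and so on. It involves \<open>n\<close>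
  inequalities on \<open>n\<close> coordinates.\<close>

primrec chain :: "real \<Rightarrow> nat \<Rightarrow> nat \<Rightarrow> real \<Rightarrow> (nat \<Rightarrow> real) \<Rightarrow> bool" where
  "chain \<theta> 0 m u x = True"
| "chain \<theta> (Suc n) m u x = (u \<le> x m \<and> chain \<theta> n (Suc m) (\<theta> * x m) x)"

text \<open>The probability of a chain of length \<open>n\<close> started at level \<open>u\<close>, computed by conditioning on its
  first entry \<open>y\<close>, which is uniform on \<open>{-a..1}\<close> and passes on the level \<open>\<theta> * y\<close>. The interval of
  integration is empty when \<open>u > 1\<close>.\<close>

primrec chain_prob :: "real \<Rightarrow> real \<Rightarrow> nat \<Rightarrow> real \<Rightarrow> real" where
  "chain_prob \<theta> a 0 u = 1"
| "chain_prob \<theta> a (Suc n) u =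
     integral {max u (-a)..1} (\<lambda>y. chain_prob \<theta> a n (\<theta> * y)) / (1 + a)"

lemma chain_iff:
  "chain \<theta> (Suc n) m u x \<longleftrightarrow> u \<le> x m \<and> (\<forall>i\<in>{m..<m + n}. \<theta> * x i \<le> x (Suc i))"
proof (induction n arbitrary: m u)
  case (Suc n)
  have "{m..<m + Suc n} = insert m {Suc m..<Suc m + n}"
    by auto
  then show ?case
    using Suc.IH[of "Suc m" "\<theta> * x m"] by auto
qed auto

lemma chain_cong:
  assumes "\<And>i. i \<ge> m \<Longrightarrow> x i = y i"
  shows "chain \<theta> n m u x = chain \<theta> n m u y"
  using assms by (induction n arbitrary: m u) auto

lemma measurable_chain:
  assumes "{m..} \<subseteq> I"
  shows "Measurable.pred (borel \<Otimes>\<^sub>M PiM I (\<lambda>_. borel)) (\<lambda>p. chain \<theta> n m (fst p) (snd p))"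
  using assms
proof (induction n arbitrary: m)
  case (Suc n)
  let ?N = "PiM I (\<lambda>_. borel :: real measure)"
  have m: "m \<in> I" and sub: "{Suc m..} \<subseteq> I"
    using Suc.prems by auto
  have [measurable]: "(\<lambda>p. snd p m) \<in> borel_measurable ((borel :: real measure) \<Otimes>\<^sub>M ?N)"
    using measurable_compose[OF measurable_snd measurable_component_singleton[OF m]] .
  have "(\<lambda>p. (\<theta> * snd p m, snd p)) \<in> (borel :: real measure) \<Otimes>\<^sub>M ?N \<rightarrow>\<^sub>M borel \<Otimes>\<^sub>M ?N"
    by measurable
  from measurable_compose[OF this Suc.IH[OF sub]]
  have [measurable]: "Measurable.pred ((borel :: real measure) \<Otimes>\<^sub>M ?N)
      (\<lambda>p. chain \<theta> n (Suc m) (\<theta> * snd p m) (snd p))"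
    by simp
  show ?case
    by simp
qed simp

text \<open>The entries after the first are independent of the first one, so Fubini turns the probability
  of the chain into an integral over its first entry.\<close>

lemma (in prob_space) prob_chain:
  assumes a: "a > -1"
    and indep: "indep_vars (\<lambda>_. borel) X {1..}"
    and unif: "\<And>i. i \<ge> 1 \<Longrightarrow> distr M borel (X i) = uniform_measure lborel {-a..1}"
    and "m \<ge> 1"
  shows "prob {\<omega> \<in> space M. chain \<theta> n m u (\<lambda>i. X i \<omega>)} = chain_prob \<theta> a n u"
  using \<open>m \<ge> 1\<close>
proof (induction n arbitrary: m u)
  case 0
  show ?case by (simp add: prob_space)
next
  case (Suc n)
  define K where "K = chain_prob \<theta> a n"
  define N where "N = PiM {Suc m..} (\<lambda>_. borel :: real measure)"
  define Y where "Y = (\<lambda>\<omega>. restrict (\<lambda>i. X i \<omega>) {Suc m..})"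
  have IH: "prob {\<omega> \<in> space M. chain \<theta> n (Suc m) v (\<lambda>i. X i \<omega>)} = K v" for v
    unfolding K_def by (rule Suc.IH) simp
  have K01: "0 \<le> K v" "K v \<le> 1" for v
    using IH[of v, symmetric] by simp_all
  \<comment> \<open>\<open>indep_var\<close> wants both variables to have values in the same type, so the first entry is
    represented by a function on the singleton index set.\<close>
  define P where "P = PiM {m} (\<lambda>_. borel :: real measure)"
  define Z where "Z = (\<lambda>\<omega>. restrict (\<lambda>i. X i \<omega>) {m})"
  have iv: "indep_var P Z N Y"
    unfolding Y_def N_def P_def Z_def
    using Suc.prems by (intro indep_var_restrict[OF indep]) auto
  have Z[measurable]: "Z \<in> M \<rightarrow>\<^sub>M P" and Y[measurable]: "Y \<in> M \<rightarrow>\<^sub>M N"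
    using indep_var_rv1[OF iv] indep_var_rv2[OF iv] by simp_all
  have [measurable]: "(\<lambda>f. f m) \<in> borel_measurable P"
    unfolding P_def by measurable
  have Zm: "Z \<omega> m = X m \<omega>" for \<omega>
    by (simp add: Z_def)
  have [measurable]: "X m \<in> borel_measurable M"
    using measurable_compose[OF Z \<open>(\<lambda>f. f m) \<in> borel_measurable P\<close>] by (simp add: Zm)
  interpret Y: prob_space "distr M N Y"
    by (rule prob_space_distr) simp
  have chain_meas[measurable]:
    "Measurable.pred (borel \<Otimes>\<^sub>M N) (\<lambda>p. chain \<theta> n (Suc m) (fst p) (snd p))"
    unfolding N_def by (rule measurable_chain) simp
  have [measurable]: "Measurable.pred (P \<Otimes>\<^sub>M N) (\<lambda>p. chain \<theta> n (Suc m) (\<theta> * fst p m) (snd p))"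
  proof -
    have "(\<lambda>p. (\<theta> * fst p m, snd p)) \<in> P \<Otimes>\<^sub>M N \<rightarrow>\<^sub>M borel \<Otimes>\<^sub>M N"
      by measurable
    from measurable_compose[OF this chain_meas] show ?thesis
      by simp
  qed
  have slice: "emeasure (distr M N Y) {x \<in> space N. chain \<theta> n (Suc m) v x} = ennreal (K v)" for v
  proof -
    have "(\<lambda>x. (v, x)) \<in> N \<rightarrow>\<^sub>M borel \<Otimes>\<^sub>M N"
      by measurable
    from measurable_compose[OF this, of "\<lambda>p. chain \<theta> n (Suc m) (fst p) (snd p)"]
    have [measurable]: "Measurable.pred N (chain \<theta> n (Suc m) v)"
      by simp
    have "emeasure (distr M N Y) {x \<in> space N. chain \<theta> n (Suc m) v x} =
        emeasure M (Y -` {x \<in> space N. chain \<theta> n (Suc m) v x} \<inter> space M)"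
      by (rule emeasure_distr) measurable
    also have "Y -` {x \<in> space N. chain \<theta> n (Suc m) v x} \<inter> space M =
        {\<omega> \<in> space M. chain \<theta> n (Suc m) v (\<lambda>i. X i \<omega>)}"
      using measurable_space[OF Y] chain_cong[of "Suc m" "Y _" "\<lambda>i. X i _" \<theta> n v]
      by (auto simp: Y_def)
    finally show ?thesis
      by (simp add: emeasure_eq_measure IH)
  qed
  \<comment> \<open>As a function of the level, the chain probability is the measure of a slice of a measurable set.\<close>
  have K_meas[measurable]: "K \<in> borel_measurable borel"
  proof -
    have "{p \<in> space (borel \<Otimes>\<^sub>M N). chain \<theta> n (Suc m) (fst p) (snd p)}
        \<in> sets (borel \<Otimes>\<^sub>M distr M N Y)"
      by (simp cong: sets_pair_measure_cong)
    from Y.measurable_emeasure_Pair[OF this]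
    have "(\<lambda>v. ennreal (K v)) \<in> borel_measurable borel"
      by (simp add: vimage_def space_pair_measure slice)
    then have "(\<lambda>v. enn2real (ennreal (K v))) \<in> borel_measurable borel"
      by measurable
    then show ?thesis
      by (simp add: K01)
  qed
  define A where "A = {p \<in> space (P \<Otimes>\<^sub>M N).
      u \<le> fst p m \<and> chain \<theta> n (Suc m) (\<theta> * fst p m) (snd p)}"
  have A[measurable]: "A \<in> sets (P \<Otimes>\<^sub>M N)"
    unfolding A_def by measurable
  have slice_A: "emeasure (distr M N Y) (Pair f -` A) =
      indicator {u..} (f m) * ennreal (K (\<theta> * f m))" if "f \<in> space P" for f
    using slice[of "\<theta> * f m"] that
    by (cases "u \<le> f m") (simp_all add: A_def vimage_def space_pair_measure)
  define S where "S = {max u (-a)..1}"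
  have int: "set_integrable lborel S (\<lambda>y. K (\<theta> * y))"
    unfolding set_integrable_def
  proof (rule Bochner_Integration.integrable_bound)
    show "integrable lborel (indicator S :: real \<Rightarrow> real)"
      by (simp add: S_def emeasure_lborel_Icc_eq)
    show "(\<lambda>y. indicator S y *\<^sub>R K (\<theta> * y)) \<in> borel_measurable lborel"
      by (simp add: S_def)
    show "AE y in lborel. norm (indicator S y *\<^sub>R K (\<theta> * y)) \<le> norm (indicator S y :: real)"
      using K01 by (auto simp: indicator_def)
  qed
  have "emeasure M {\<omega> \<in> space M. chain \<theta> (Suc n) m u (\<lambda>i. X i \<omega>)} =
      emeasure M ((\<lambda>\<omega>. (Z \<omega>, Y \<omega>)) -` A \<inter> space M)"
  proof (rule arg_cong[where f = "emeasure M"])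
    show "{\<omega> \<in> space M. chain \<theta> (Suc n) m u (\<lambda>i. X i \<omega>)} =
        (\<lambda>\<omega>. (Z \<omega>, Y \<omega>)) -` A \<inter> space M"
      using measurable_space[OF Y] measurable_space[OF Z]
        chain_cong[of "Suc m" "Y _" "\<lambda>i. X i _" \<theta> n "\<theta> * X m _"]
      by (auto simp: A_def Y_def Zm space_pair_measure)
  qed
  also have "\<dots> = emeasure (distr M (P \<Otimes>\<^sub>M N) (\<lambda>\<omega>. (Z \<omega>, Y \<omega>))) A"
    by (rule emeasure_distr[symmetric]) measurable
  also have "\<dots> = emeasure (distr M P Z \<Otimes>\<^sub>M distr M N Y) A"
    using iv by (simp add: indep_var_distribution_eq)
  also have "\<dots> = (\<integral>\<^sup>+f. emeasure (distr M N Y) (Pair f -` A) \<partial>distr M P Z)"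
    by (rule Y.emeasure_pair_measure_alt) (use A in \<open>simp cong: sets_pair_measure_cong\<close>)
  also have "\<dots> = (\<integral>\<^sup>+f. indicator {u..} (f m) * ennreal (K (\<theta> * f m)) \<partial>distr M P Z)"
    by (rule nn_integral_cong) (simp add: slice_A)
  also have "\<dots> = (\<integral>\<^sup>+\<omega>. indicator {u..} (X m \<omega>) * ennreal (K (\<theta> * X m \<omega>)) \<partial>M)"
    by (subst nn_integral_distr) (simp_all add: Zm)
  also have "\<dots> = (\<integral>\<^sup>+y. indicator {u..} y * ennreal (K (\<theta> * y)) \<partial>distr M borel (X m))"
    by (subst nn_integral_distr) simp_all
  also have "\<dots> = (\<integral>\<^sup>+y. indicator {u..} y * ennreal (K (\<theta> * y)) \<partial>uniform_measure lborel {-a..1})"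
    using unif[OF Suc.prems] by simp
  also have "\<dots> = (\<integral>\<^sup>+y. indicator {u..} y * ennreal (K (\<theta> * y)) * indicator {-a..1} y \<partial>lborel)
      / emeasure lborel {-a..1}"
    by (rule nn_integral_uniform_measure) simp_all
  also have "(\<integral>\<^sup>+y. indicator {u..} y * ennreal (K (\<theta> * y)) * indicator {-a..1} y \<partial>lborel) =
      (\<integral>\<^sup>+y. ennreal (indicator S y *\<^sub>R K (\<theta> * y)) \<partial>lborel)"
    by (rule nn_integral_cong) (auto simp: S_def indicator_def)
  also have "\<dots> = ennreal (integral S (\<lambda>y. K (\<theta> * y)))"
  proof -
    have "(\<integral>\<^sup>+y. ennreal (indicator S y *\<^sub>R K (\<theta> * y)) \<partial>lborel) =
        ennreal (LINT y : S | lborel. K (\<theta> * y))"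
      unfolding set_lebesgue_integral_def
      using int K01 by (intro nn_integral_eq_integral) (auto simp: set_integrable_def)
    then show ?thesis
      using set_borel_integral_eq_integral(2)[OF int] by simp
  qed
  also have "emeasure lborel {-a..1} = ennreal (1 + a)"
    using a by simp
  also have "ennreal (integral S (\<lambda>y. K (\<theta> * y))) / ennreal (1 + a) =
      ennreal (integral S (\<lambda>y. K (\<theta> * y)) / (1 + a))"
    using a K01 by (intro divide_ennreal integral_nonneg set_borel_integral_eq_integral(1)[OF int]) auto
  finally show ?case
    using a K01 set_borel_integral_eq_integral(1)[OF int]
    by (simp add: emeasure_eq_measure K_def S_def del: chain.simps) (simp add: integral_nonneg)
qed

text \<open>Level \<open>-a\<close> imposes no condition on the first entry, so \<open>n\<close> comparisons between \<open>n + 1\<close> variables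
  form a chain of length \<open>n + 1\<close> started at \<open>-a\<close>.\<close>

lemma persistence_prob_eq_chain_prob:
  assumes a: "a > -1"
    and "prob_space M"
    and indep: "prob_space.indep_vars M (\<lambda>_. borel) X {1..}"
    and unif: "\<And>i. i \<ge> 1 \<Longrightarrow> distr M borel (X i) = uniform_measure lborel {-a..1}"
  shows "persistence_prob M X \<theta> n = chain_prob \<theta> a (Suc n) (-a)"
proof -
  interpret prob_space M by fact
  have X[measurable]: "X i \<in> borel_measurable M" if "i \<ge> 1" for i
    using indep that by (auto simp: indep_vars_def)
  have "AE \<omega> in M. -a \<le> X 1 \<omega>"
  proof -
    have "AE y in distr M borel (X 1). -a \<le> y"
      unfolding unif[OF order_refl]
      by (rule AE_uniform_measureI) auto
    then show ?thesis
      by (subst (asm) AE_distr_iff) auto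
  qed
  then have "prob {\<omega> \<in> space M. chain \<theta> (Suc n) 1 (-a) (\<lambda>i. X i \<omega>)} =
      prob {\<omega> \<in> space M. \<forall>i\<in>{1..n}. X (i + 1) \<omega> \<ge> \<theta> * X i \<omega>}"
    by (intro measure_eq_AE) (auto simp: chain_iff atLeastLessThanSuc_atLeastAtMost simp del: chain.simps)
  moreover have "persistence_prob M X \<theta> n =
      prob {\<omega> \<in> space M. \<forall>i\<in>{1..n}. X (i + 1) \<omega> \<ge> \<theta> * X i \<omega>}"
    by (simp add: persistence_prob_def prob_space)
  ultimately show ?thesis
    using prob_chain[OF a indep unif, of 1 \<theta> "Suc n" "-a"] by (simp del: chain.simps)
qed

lemma chain_prob_below:
  assumes "u \<le> -a"
  shows "chain_prob \<theta> a n u = chain_prob \<theta> a n (-a)"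
  using assms by (cases n) (simp_all add: max_absorb2)

lemma chain_prob_above:
  assumes "1 \<le> u"
  shows "chain_prob \<theta> a (Suc n) u = 0"
proof (cases "max u (-a) = 1")
  case True
  then show ?thesis
    using integral_refl[of 1] by simp
next
  case False
  then have "{max u (-a)..1} = {}"
    using assms by auto
  then show ?thesis
    by simp
qed

section \<open>Deformed exponentials and their Appell polynomials\<close>

text \<open>The coefficient of \<open>z ^ n\<close> in \<open>C(z) * E(\<theta>, -u z / (1 + a))\<close>. It is a polynomial of degree at most
  \<open>n\<close> in \<open>u\<close>, and these polynomials form a deformed Appell sequence: differentiation lowers the
  index and rescales the argument by \<open>\<theta>\<close>.\<close>

definition appell :: "real \<Rightarrow> real \<Rightarrow> real fps \<Rightarrow> nat \<Rightarrow> real \<Rightarrow> real" where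
  "appell \<theta> a C n u = fps_nth (C * deformed_exp \<theta> (fps_const (- u / (1 + a)) * fps_X)) n"

text \<open>This is the functional equation \<open>E'(\<theta>, z) = E(\<theta>, \<theta> z)\<close>, read coefficientwise.\<close>

lemma has_real_derivative_appell:
  assumes "a > -1"
  shows "(appell \<theta> a C (Suc n) has_real_derivative - appell \<theta> a C n (\<theta> * u) / (1 + a)) (at u)"
proof -
  define e where "e = (\<lambda>k u. \<theta> ^ (k * (k - 1) div 2) / fact k * (- u / (1 + a)) ^ k)"
  have nth: "appell \<theta> a C k v = (\<Sum>i=0..k. e i v * fps_nth C (k - i))" for k v
    unfolding appell_def by (subst mult.commute) (simp only: fps_mult_nth deformed_exp_nth e_def)
  have e0: "e 0 v = 1" for v
    by (simp add: e_def)
  have de: "(e (Suc k) has_real_derivative - e k (\<theta> * v) / (1 + a)) (at v)" for k v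
  proof -
    have "Suc k * (Suc k - 1) div 2 = k * (k - 1) div 2 + k"
      by (cases k) (auto simp: algebra_simps)
    then have pow: "\<theta> ^ (Suc k * (Suc k - 1) div 2) = \<theta> ^ (k * (k - 1) div 2) * \<theta> ^ k"
      by (simp only: power_add)
    have "- (\<theta> * v) / (1 + a) = \<theta> * (- v / (1 + a))"
      by simp
    then have ek: "e k (\<theta> * v) = \<theta> ^ (k * (k - 1) div 2) / fact k * (\<theta> ^ k * (- v / (1 + a)) ^ k)"
      by (simp only: e_def power_mult_distrib)
    have "((\<lambda>v. - v / (1 + a)) has_real_derivative - 1 / (1 + a)) (at v)"
      by (intro DERIV_cdivide DERIV_minus DERIV_ident)
    from DERIV_cmult[OF DERIV_power_Suc[OF this, of k]]
    have "(e (Suc k) has_real_derivative \<theta> ^ (Suc k * (Suc k - 1) div 2) / fact (Suc k) *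
          ((1 + real k) * (- 1 / (1 + a) * (- v / (1 + a)) ^ k))) (at v)"
      unfolding e_def .
    also have "\<theta> ^ (Suc k * (Suc k - 1) div 2) / fact (Suc k) *
          ((1 + real k) * (- 1 / (1 + a) * (- v / (1 + a)) ^ k)) = - e k (\<theta> * v) / (1 + a)"
      unfolding pow ek fact_Suc of_nat_Suc by (simp add: add_nonneg_eq_0_iff)
    finally show ?thesis .
  qed
  have "appell \<theta> a C (Suc n) =
      (\<lambda>v. fps_nth C (Suc n) + (\<Sum>i=0..n. e (Suc i) v * fps_nth C (n - i)))"
    by (rule ext) (simp add: nth sum.atLeast0_atMost_Suc_shift e0 del: sum.cl_ivl_Suc)
  then show ?thesis
    by (auto intro!: derivative_eq_intros de simp: nth sum_negf sum_divide_distrib)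
qed

lemma has_integral_appell:
  assumes "a > -1" "u \<le> v"
  shows "((\<lambda>y. appell \<theta> a C n (\<theta> * y)) has_integral
    (1 + a) * (appell \<theta> a C (Suc n) u - appell \<theta> a C (Suc n) v)) {u..v}"
proof -
  let ?F = "\<lambda>y. - (1 + a) * appell \<theta> a C (Suc n) y"
  have "(?F has_real_derivative appell \<theta> a C n (\<theta> * y)) (at y within {u..v})" for y
  proof (rule has_field_derivative_at_within)
    have "- (1 + a) * (- appell \<theta> a C n (\<theta> * y) / (1 + a)) = appell \<theta> a C n (\<theta> * y)"
      using assms(1) by (simp add: field_simps)
    then show "(?F has_real_derivative appell \<theta> a C n (\<theta> * y)) (at y)"
      using DERIV_cmult[OF has_real_derivative_appell[OF assms(1), of \<theta> C n y], of "- (1 + a)"]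
      by (simp only:)
  qed
  then have "((\<lambda>y. appell \<theta> a C n (\<theta> * y)) has_integral (?F v - ?F u)) {u..v}"
    using assms(2) by (intro fundamental_theorem_of_calculus)
      (auto simp: has_real_derivative_iff_has_vector_derivative)
  then show ?thesis
    by (simp add: algebra_simps)
qed

lemma deformed_exp_mult_inverse:
  "deformed_exp r (fps_const c * fps_X) * inverse (deformed_exp r (fps_const c * fps_X)) = 1"
  by (rule inverse_mult_eq_1') (simp add: deformed_exp_nth_0)

lemma eq_divideI_mult:
  fixes S N D :: "'b :: semidom_divide"
  assumes "D \<noteq> 0" "S * D = N"
  shows "S = N div D"
  using assms nonzero_mult_div_cancel_right by metis

lemma fps_shifted_quotient_eqI:
  fixes S N E :: "'b :: field fps"
  assumes "fps_nth E 0 = 1" "1 + fps_X * S = inverse E * N"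
  shows "S = (N - E) / (fps_X * E)"
proof (rule eq_divideI_mult)
  show "fps_X * E \<noteq> 0"
    using assms(1) by auto
  have E: "E * inverse E = 1"
    by (rule inverse_mult_eq_1') (simp add: assms(1))
  have "(1 + fps_X * S) * E = N * (E * inverse E)"
    unfolding assms(2) by (simp only: mult_ac)
  then show "S * (fps_X * E) = N - E"
    by (simp add: E algebra_simps)
qed

section \<open>Levels in an interval preserved by multiplication\<close>

text \<open>With \<open>C = 1 / E(\<theta>, -z / (1 + a))\<close> the Appell polynomials satisfy the boundary conditions of the
  chain probabilities: value 1 for the empty chain, value 0 for nonempty chains started at 1.\<close>

lemma appell_normalized:
  fixes \<theta> a :: real
  assumes "a > -1"
  defines "C \<equiv> inverse (deformed_exp \<theta> (fps_const (-1 / (1 + a)) * fps_X))"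
  shows "appell \<theta> a C 0 u = 1" "appell \<theta> a C (Suc n) 1 = 0"
proof -
  show "appell \<theta> a C 0 u = 1"
    by (simp add: appell_def C_def deformed_exp_nth_0)
  show "appell \<theta> a C (Suc n) 1 = 0"
    using deformed_exp_mult_inverse[of \<theta> "-1 / (1 + a)"]
    by (simp add: appell_def C_def mult.commute)
qed

lemma chain_prob_eq_appell_step:
  assumes "a > -1" and "-a \<le> u" "u \<le> 1"
    and "\<And>y. u \<le> y \<Longrightarrow> y \<le> 1 \<Longrightarrow> chain_prob \<theta> a n (\<theta> * y) = appell \<theta> a C n (\<theta> * y)"
  shows "chain_prob \<theta> a (Suc n) u = appell \<theta> a C (Suc n) u - appell \<theta> a C (Suc n) 1"
proof -
  have "((\<lambda>y. chain_prob \<theta> a n (\<theta> * y)) has_integral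
      (1 + a) * (appell \<theta> a C (Suc n) u - appell \<theta> a C (Suc n) 1)) {u..1}"
    using has_integral_appell[OF assms(1) \<open>u \<le> 1\<close>, of \<theta> C n]
    by (rule has_integral_eq[rotated]) (simp add: assms(4))
  with assms show ?thesis
    by (simp add: max_absorb1 integral_unique)
qed

text \<open>If multiplication by \<open>\<theta>\<close> maps \<open>{-a..1}\<close> into itself, every level reached by a chain stays in
  that interval, so the Appell polynomials describe the chain probabilities there.\<close>

lemma chain_prob_eq_appell_if_stable:
  assumes a: "a > -1"
    and range: "\<And>y. -a \<le> y \<Longrightarrow> y \<le> 1 \<Longrightarrow> -a \<le> \<theta> * y \<and> \<theta> * y \<le> 1"
    and "-a \<le> u" "u \<le> 1"
  shows "chain_prob \<theta> a n u =
    appell \<theta> a (inverse (deformed_exp \<theta> (fps_const (-1 / (1 + a)) * fps_X))) n u"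
  using assms(3,4)
proof (induction n arbitrary: u)
  case 0
  then show ?case
    by (simp only: appell_normalized[OF a] chain_prob.simps)
next
  case (Suc n)
  have "chain_prob \<theta> a (Suc n) u =
    appell \<theta> a (inverse (deformed_exp \<theta> (fps_const (-1 / (1 + a)) * fps_X))) (Suc n) u -
    appell \<theta> a (inverse (deformed_exp \<theta> (fps_const (-1 / (1 + a)) * fps_X))) (Suc n) 1"
    using Suc.prems by (intro chain_prob_eq_appell_step[OF a] Suc.IH) (use range in auto)
  then show ?case
    by (simp only: appell_normalized[OF a] diff_zero)
qed

lemma mult_stable_interval:
  fixes \<theta> a y :: real
  assumes cases: "(0 \<le> \<theta> \<and> \<theta> \<le> 1 \<and> a \<ge> 0) \<or> (-1 \<le> \<theta> \<and> \<theta> < 0 \<and> -\<theta> \<le> a \<and> a \<le> -1/\<theta>)"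
    and that: "-a \<le> y" "y \<le> 1"
  shows "-a \<le> \<theta> * y \<and> \<theta> * y \<le> 1"
  using cases
proof
  assume *: "0 \<le> \<theta> \<and> \<theta> \<le> 1 \<and> a \<ge> 0"
  have "\<theta> * (-a) \<le> \<theta> * y" "\<theta> * y \<le> \<theta> * 1" "\<theta> * a \<le> 1 * a"
    by (rule mult_left_mono mult_right_mono; use * that in simp)+
  with * show ?thesis by auto
next
  assume *: "-1 \<le> \<theta> \<and> \<theta> < 0 \<and> -\<theta> \<le> a \<and> a \<le> -1/\<theta>"
  have "\<theta> * y \<le> \<theta> * (-a)" "\<theta> * 1 \<le> \<theta> * y"
    by (rule mult_left_mono_neg; use * that in simp)+
  moreover have "\<theta> * (-a) \<le> 1"
    using * by (auto simp: field_simps)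
  ultimately show ?thesis
    using * by linarith
qed

lemma chain_prob_series_stable:
  assumes a: "a > -1"
    and range: "\<And>y. -a \<le> y \<Longrightarrow> y \<le> 1 \<Longrightarrow> -a \<le> \<theta> * y \<and> \<theta> * y \<le> 1"
  shows "Abs_fps (\<lambda>n. chain_prob \<theta> a (Suc n) (-a)) =
         (deformed_exp \<theta> (fps_const (a / (1 + a)) * fps_X)
            - deformed_exp \<theta> (fps_const (-1 / (1 + a)) * fps_X))
         / (fps_X * deformed_exp \<theta> (fps_const (-1 / (1 + a)) * fps_X))"
    (is "?S = (?N - ?E) / (fps_X * ?E)")
proof (rule fps_shifted_quotient_eqI)
  show "fps_nth ?E 0 = 1"
    by (rule deformed_exp_nth_0)
  show "1 + fps_X * ?S = inverse ?E * ?N"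
  proof (rule fps_ext)
    fix n
    have "fps_nth (inverse ?E * ?N) n = chain_prob \<theta> a n (-a)"
      using chain_prob_eq_appell_if_stable[OF a range, of "-a" n] a by (simp add: appell_def)
    then show "fps_nth (1 + fps_X * ?S) n = fps_nth (inverse ?E * ?N) n"
      by (cases n) simp_all
  qed
qed

text \<open>For \<open>\<theta> < 0\<close> and \<open>a \<ge> -1 / \<theta>\<close>, multiplication by \<open>\<theta>\<close> maps \<open>{\<theta>..1}\<close> into itself, and a first entry
  below \<open>1 / \<theta>\<close> would force the next one above 1. So the integral giving the chain probability at level
  \<open>-a\<close> effectively starts at \<open>1 / \<theta>\<close>. This fails for chains of length one, which have no second
  entry; hence the additional constant.\<close>

lemma chain_prob_series_neg_large:
  assumes a: "a > -1" and \<theta>: "-1 \<le> \<theta>" "\<theta> < 0" and a_ge: "a \<ge> -1/\<theta>"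
  shows "Abs_fps (\<lambda>n. chain_prob \<theta> a (Suc n) (-a)) =
         fps_const ((\<theta> * a + 1) / (\<theta> * (1 + a)))
         + (deformed_exp \<theta> (fps_const (-1 / (\<theta> * (1 + a))) * fps_X)
              - deformed_exp \<theta> (fps_const (-1 / (1 + a)) * fps_X))
           / (fps_X * deformed_exp \<theta> (fps_const (-1 / (1 + a)) * fps_X))"
    (is "?S = ?c + (?N - ?E) / (fps_X * ?E)")
proof -
  define C where "C = inverse ?E"
  let ?P = "appell \<theta> a C"
  have P_0: "?P 0 u = 1" for u
    unfolding C_def by (rule appell_normalized[OF a])
  have P_1: "?P (Suc n) 1 = 0" for n
    unfolding C_def by (rule appell_normalized[OF a])
  have th: "1 / \<theta> \<le> -1" "-a \<le> 1/\<theta>"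
    using \<theta> a_ge by (auto simp: field_simps)
  have closed: "chain_prob \<theta> a n u = ?P n u" if "\<theta> \<le> u" "u \<le> 1" for n u
    using that
  proof (induction n arbitrary: u)
    case 0
    then show ?case
      by (simp only: P_0 chain_prob.simps)
  next
    case (Suc n)
    have "chain_prob \<theta> a (Suc n) u = ?P (Suc n) u - ?P (Suc n) 1"
    proof (rule chain_prob_eq_appell_step[OF a])
      show "-a \<le> u"
        using th \<theta> Suc.prems by linarith
      fix y assume y: "u \<le> y" "y \<le> 1"
      have "\<theta> * 1 \<le> \<theta> * y" "\<theta> * y \<le> \<theta> * (-1)"
        by (rule mult_left_mono_neg; use y \<theta> Suc.prems in simp)+
      then show "chain_prob \<theta> a n (\<theta> * y) = ?P n (\<theta> * y)"
        using \<theta> by (intro Suc.IH) auto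
    qed (use Suc.prems in auto)
    then show ?case
      by (simp only: P_1 diff_zero)
  qed
  have p_Suc: "chain_prob \<theta> a (Suc (Suc n)) (-a) = ?P (Suc (Suc n)) (1 / \<theta>)" for n
  proof -
    let ?k = "\<lambda>y. chain_prob \<theta> a (Suc n) (\<theta> * y)"
    have "?k y = 0" if "y \<in> {-a..1/\<theta>}" for y
      using that \<theta> by (intro chain_prob_above) (simp add: field_simps)
    then have left: "(?k has_integral 0) {-a..1/\<theta>}"
      by (rule has_integral_is_0)
    have "\<theta> \<le> \<theta> * y \<and> \<theta> * y \<le> 1" if "y \<in> {1/\<theta>..1}" for y
      using that \<theta> mult_left_mono_neg[of y 1 \<theta>] by (auto simp: field_simps)
    then have "(?k has_integral (1 + a) * (?P (Suc (Suc n)) (1/\<theta>) - ?P (Suc (Suc n)) 1)) {1/\<theta>..1}"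
      using th \<theta>
      by (intro has_integral_eq[OF _ has_integral_appell[OF a]]) (auto simp: closed simp del: chain_prob.simps)
    from has_integral_combine[OF _ _ left this] th \<theta>
    have "(?k has_integral (1 + a) * ?P (Suc (Suc n)) (1/\<theta>)) {-a..1}"
      by (simp add: P_0 P_1 del: chain_prob.simps)
    then show ?thesis
      using a unfolding chain_prob.simps(2)[of \<theta> a "Suc n"]
      by (simp add: integral_unique del: chain_prob.simps)
  qed
  have p_0: "chain_prob \<theta> a (Suc 0) (-a) = (\<theta> * a + 1) / (\<theta> * (1 + a)) + ?P (Suc 0) (1 / \<theta>)"
  proof -
    have "chain_prob \<theta> a (Suc 0) (-a) = 1"
      using a by simp
    moreover have "(1 + a) * (?P (Suc 0) (1/\<theta>) - ?P (Suc 0) 1) = 1 - 1/\<theta>"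
    proof (rule has_integral_unique)
      show "((\<lambda>y. ?P 0 (\<theta> * y)) has_integral (1 + a) * (?P (Suc 0) (1/\<theta>) - ?P (Suc 0) 1)) {1/\<theta>..1}"
        using th by (intro has_integral_appell[OF a]) auto
      show "((\<lambda>y. ?P 0 (\<theta> * y)) has_integral 1 - 1/\<theta>) {1/\<theta>..1}"
        using has_integral_const_real[of "1::real" "1/\<theta>" 1] th by (simp add: P_0 P_1)
    qed
    then have "?P (Suc 0) (1/\<theta>) = (1 - 1/\<theta>) / (1 + a)"
      using a by (simp add: P_1 eq_divide_eq mult.commute)
    moreover have "(\<theta> * a + 1) / (\<theta> * (1 + a)) + (1 - 1/\<theta>) / (1 + a) = 1"
    proof -
      have "(1 - 1/\<theta>) / (1 + a) = (\<theta> - 1) / (\<theta> * (1 + a))"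
        using \<theta> by (simp add: diff_divide_distrib)
      moreover have "\<theta> * (1 + a) \<noteq> 0"
        using a \<theta> by simp
      ultimately show ?thesis
        by (simp add: add_divide_distrib[symmetric] algebra_simps)
    qed
    ultimately show ?thesis
      by (simp only:)
  qed
  have "?S - ?c = (?N - ?E) / (fps_X * ?E)"
  proof (rule fps_shifted_quotient_eqI)
    show "fps_nth ?E 0 = 1"
      by (rule deformed_exp_nth_0)
    show "1 + fps_X * (?S - ?c) = inverse ?E * ?N"
      unfolding C_def[symmetric]
    proof (rule fps_ext)
      fix n
      have P: "fps_nth (C * ?N) n = ?P n (1/\<theta>)"
        by (simp add: appell_def)
      show "fps_nth (1 + fps_X * (?S - ?c)) n = fps_nth (C * ?N) n"
        unfolding P
      proof (cases n)
        case (Suc k)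
        then show "fps_nth (1 + fps_X * (?S - ?c)) n = ?P n (1/\<theta>)"
          by (cases k) (simp_all add: p_0 p_Suc del: chain_prob.simps)
      qed (simp add: P_0)
    qed
  qed
  then show ?thesis
    by (simp only: diff_eq_eq add.commute)
qed

text \<open>For \<open>\<theta> < 0\<close> and \<open>a \<le> -\<theta>\<close>, a first entry above \<open>-a / \<theta>\<close> imposes no condition on the next one, and
  multiplication by \<open>\<theta>\<close> maps \<open>{-a..-a/\<theta>}\<close> into itself. On that interval the chain probabilities
  are Appell polynomials for a factor \<open>C\<close> that depends on their own values at \<open>-a\<close>; if \<open>Q\<close> denotes
  the generating series of these values, the conditions at the two end points are
  \<open>C * E(\<theta>, a z / (1 + a)) = Q\<close> and \<open>C * E(\<theta>, a z / (\<theta> (1 + a))) = 1 + \<kappa> z Q\<close>, where \<open>\<kappa>\<close> is the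
  probability of an entry above \<open>-a / \<theta>\<close>. They can be solved for \<open>Q\<close>.\<close>

lemma chain_prob_series_neg_small:
  assumes \<theta>: "-1 \<le> \<theta>" "\<theta> < 0" and a: "0 \<le> a" "a \<le> -\<theta>"
  shows "Abs_fps (\<lambda>n. chain_prob \<theta> a (Suc n) (-a)) =
         (1 / (deformed_exp \<theta> (fps_const (a / (\<theta> * (1 + a))) * fps_X)
                 / deformed_exp \<theta> (fps_const (a / (1 + a)) * fps_X)
               - fps_const ((1 + a / \<theta>) / (1 + a)) * fps_X)
          - 1) / fps_X"
    (is "?S = (1 / (?R / ?E - fps_const ?\<kappa> * fps_X) - 1) / fps_X")
proof -
  have a': "a > -1"
    using a by simp
  define D where "D = ?R / ?E - fps_const ?\<kappa> * fps_X"
  define Q where "Q = 1 / D"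
  define C where "C = Q * inverse ?E"
  let ?P = "appell \<theta> a C"
  have D0: "fps_nth D 0 = 1"
    by (simp add: D_def deformed_exp_nth_0 fps_divide_unit)
  have QD: "Q * D = 1"
    unfolding Q_def D_def by (rule deformed_exp_reciprocal_exact(1))
  have CE: "C * ?E = Q"
    using deformed_exp_mult_inverse[of \<theta> "a / (1 + a)"] by (simp add: C_def mult_ac)
  have RE: "?R / ?E = ?R * inverse ?E"
    by (rule fps_divide_unit) (simp add: deformed_exp_nth_0)
  have CR: "C * ?R = 1 + fps_const ?\<kappa> * fps_X * Q"
  proof -
    have "C * ?R = Q * (?R / ?E)"
      unfolding RE C_def by (simp only: mult_ac)
    also have "?R / ?E = D + fps_const ?\<kappa> * fps_X"
      unfolding D_def by simp
    also have "Q * (D + fps_const ?\<kappa> * fps_X) = 1 + fps_const ?\<kappa> * fps_X * Q"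
      unfolding distrib_left QD by (simp only: mult_ac)
    finally show ?thesis .
  qed
  have P_left: "?P n (-a) = fps_nth Q n" for n
    using CE by (simp add: appell_def)
  have "- (- a / \<theta>) / (1 + a) = a / (\<theta> * (1 + a))"
    by simp
  then have P_right: "?P n (-a/\<theta>) = (if n = 0 then 1 else ?\<kappa> * fps_nth Q (n - 1))" for n
    by (cases n) (simp_all add: appell_def CR mult.assoc)
  have th: "-a \<le> -a/\<theta>" "-a/\<theta> \<le> 1" "-\<theta> * a \<le> -a/\<theta>"
  proof -
    have "\<theta> * a \<le> 0"
      using \<theta> a by (intro mult_nonpos_nonneg) auto
    then show "-a \<le> -a/\<theta>" "-a/\<theta> \<le> 1"
      using \<theta> a by (auto simp: field_simps)
    have "a * (\<theta> * \<theta>) \<le> a * 1"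
      using \<theta> a by (intro mult_left_mono) (auto simp: square_le_1 simp flip: power2_eq_square)
    then show "-\<theta> * a \<le> -a/\<theta>"
      using \<theta> by (simp add: field_simps)
  qed
  have closed: "chain_prob \<theta> a n u = ?P n u" if "-a \<le> u" "u \<le> -a/\<theta>" for n u
    using that
  proof (induction n arbitrary: u)
    case 0
    have "?P 0 u = fps_nth Q 0"
      by (simp add: appell_def C_def deformed_exp_nth_0)
    also have "\<dots> = 1"
      using arg_cong[OF QD, of "\<lambda>f. fps_nth f 0"] D0 by simp
    finally show ?case
      by simp
  next
    case (Suc n)
    let ?k = "\<lambda>y. chain_prob \<theta> a n (\<theta> * y)"
    have "-a \<le> \<theta> * y \<and> \<theta> * y \<le> -a/\<theta>" if "u \<le> y" "y \<le> -a/\<theta>" for y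
    proof
      have "\<theta> * (-a/\<theta>) \<le> \<theta> * y" "\<theta> * y \<le> \<theta> * (-a)"
        by (rule mult_left_mono_neg; use that \<theta> Suc.prems in simp)+
      then show "-a \<le> \<theta> * y" "\<theta> * y \<le> -a/\<theta>"
        using \<theta> th(3) by auto
    qed
    then have left: "(?k has_integral (1 + a) * (?P (Suc n) u - ?P (Suc n) (-a/\<theta>))) {u..-a/\<theta>}"
      using Suc.prems
      by (intro has_integral_eq[OF _ has_integral_appell[OF a']]) (auto simp: Suc.IH)
    have "?k y = fps_nth Q n" if "y \<in> {-a/\<theta>..1}" for y
    proof -
      have "\<theta> * y \<le> \<theta> * (-a/\<theta>)"
        using that \<theta> by (intro mult_left_mono_neg) auto
      then have "?k y = chain_prob \<theta> a n (-a)"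
        using \<theta> by (intro chain_prob_below) simp
      also have "\<dots> = fps_nth Q n"
        using Suc.IH[of "-a"] th(1) P_left by simp
      finally show ?thesis .
    qed
    moreover have "((\<lambda>_. fps_nth Q n) has_integral (1 + a/\<theta>) * fps_nth Q n) {-a/\<theta>..1}"
      using has_integral_const_real[of "fps_nth Q n" "-a/\<theta>" 1] th(2) by simp
    ultimately have right: "(?k has_integral (1 + a/\<theta>) * fps_nth Q n) {-a/\<theta>..1}"
      by (metis (lifting) has_integral_eq)
    have "(1 + a) * ?P (Suc n) (-a/\<theta>) = (1 + a/\<theta>) * fps_nth Q n"
      using a' unfolding P_right by simp
    then have "(1 + a) * (?P (Suc n) u - ?P (Suc n) (-a/\<theta>)) + (1 + a/\<theta>) * fps_nth Q n =
        (1 + a) * ?P (Suc n) u"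
      by (simp only: right_diff_distrib diff_add_cancel)
    with has_integral_combine[OF _ _ left right] Suc.prems th(2)
    have "(?k has_integral (1 + a) * ?P (Suc n) u) {u..1}"
      by (simp only:)
    then show ?case
      using a' Suc.prems by (simp add: integral_unique max_absorb1)
  qed
  show ?thesis
    unfolding D_def[symmetric] Q_def[symmetric]
  proof (rule eq_divideI_mult)
    have "fps_nth (1 + ?S * fps_X) n = fps_nth Q n" for n
    proof -
      have "fps_nth Q n = chain_prob \<theta> a n (-a)"
        using closed[of "-a" n] th(1) P_left[of n] by simp
      then show ?thesis
        by (cases n) (simp_all del: chain_prob.simps(2))
    qed
    then have "1 + ?S * fps_X = Q"
      by (rule fps_ext)
    then show "?S * fps_X = Q - 1"
      by (simp add: algebra_simps)
  qed simp
qed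

section \<open>Inclusion-exclusion over reversed inequalities\<close>

text \<open>For \<open>0 < \<theta> \<le> 1\<close>, \<open>-1 < a \<le> 0\<close> and \<open>u \<le> 1\<close>, this is the probability of the chain with all
  inequalities reversed, that is of \<open>X 1 < u\<close>, \<open>X 2 < \<theta> * X 1\<close>, ..., \<open>X i < \<theta> * X (i - 1)\<close>. It is given
  in closed form; only the recursion that it satisfies is used.\<close>

primrec descent_prob :: "real \<Rightarrow> real \<Rightarrow> nat \<Rightarrow> real \<Rightarrow> real" where
  "descent_prob \<theta> a 0 u = 1"
| "descent_prob \<theta> a (Suc i) u = max (\<theta> ^ i * u + a) 0 ^ Suc i /
     (fact (Suc i) * \<theta> ^ (i * (i + 1) div 2) * (1 + a) ^ Suc i)"

lemma has_real_derivative_pos_part_power: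
  fixes x :: real
  assumes "x \<noteq> 0"
  shows "((\<lambda>x. max x 0 ^ Suc (Suc n)) has_real_derivative real (Suc (Suc n)) * max x 0 ^ Suc n) (at x)"
proof (cases "x > 0")
  case True
  have "((\<lambda>x. x ^ Suc (Suc n)) has_real_derivative real (Suc (Suc n)) * max x 0 ^ Suc n) (at x)"
    using True DERIV_pow[of "Suc (Suc n)" x UNIV] by (simp add: max_absorb1)
  then show ?thesis
    by (rule has_field_derivative_transform_within_open[of _ _ _ "{0<..}"]) (use True in auto)
next
  case False
  then have "((\<lambda>x. 0) has_real_derivative real (Suc (Suc n)) * max x 0 ^ Suc n) (at x)"
    by (simp add: max_absorb2)
  then show ?thesis
    by (rule has_field_derivative_transform_within_open[of _ _ _ "{..<0}"]) (use False assms in auto)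
qed

lemma descent_prob_below:
  assumes "0 \<le> \<theta>" "\<theta> \<le> 1" "a \<le> 0" "u \<le> -a"
  shows "descent_prob \<theta> a (Suc i) u = 0"
proof -
  have "\<theta> ^ i * u \<le> \<theta> ^ i * (-a)"
    using assms by (intro mult_left_mono) auto
  also have "\<dots> \<le> 1 * (-a)"
    using assms by (intro mult_right_mono power_le_one) auto
  finally show ?thesis
    by (simp add: max_absorb2)
qed

lemma has_integral_descent_prob:
  assumes \<theta>: "0 < \<theta>" "\<theta> \<le> 1" and a: "a > -1" "a \<le> 0" and v: "-a \<le> v"
  shows "((\<lambda>y. descent_prob \<theta> a i (\<theta> * y)) has_integral
    (1 + a) * descent_prob \<theta> a (Suc i) v) {-a..v}"
proof (cases i)
  case 0
  then show ?thesis
    using has_integral_const_real[of "1::real" "-a" v] a v by (simp add: max_absorb1)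
next
  case (Suc j)
  let ?F = "\<lambda>y. (1 + a) * descent_prob \<theta> a (Suc (Suc j)) y"
  define c where "c = \<theta> ^ Suc j"
  define B where "B = \<theta> ^ (j * (j + 1) div 2)"
  have pos: "c > 0" "B > 0"
    using \<theta> by (simp_all add: c_def B_def)
  have "Suc j * (Suc j + 1) div 2 = j * (j + 1) div 2 + Suc j"
    by simp
  then have cB: "\<theta> ^ (Suc j * (Suc j + 1) div 2) = B * c"
    unfolding B_def c_def by (simp only: power_add)
  have "((\<lambda>y. descent_prob \<theta> a (Suc j) (\<theta> * y)) has_integral ?F v - ?F (-a)) {-a..v}"
    \<comment> \<open>The positive part has a kink where its argument \<open>c * y + a\<close> vanishes.\<close>
  proof (rule fundamental_theorem_of_calculus_interior_strong[where S = "{- a / c}"])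
    fix y assume y: "y \<in> {-a<..<v} - {- a / c}"
    then have nz: "c * y + a \<noteq> 0"
      using pos by (auto simp: field_simps)
    have "((\<lambda>y. c * y + a) has_real_derivative c) (at y)"
      by (auto intro!: derivative_eq_intros)
    from DERIV_chain2[OF has_real_derivative_pos_part_power[OF nz, of j] this]
    have "((\<lambda>y. max (c * y + a) 0 ^ Suc (Suc j)) has_real_derivative
        real (Suc (Suc j)) * max (c * y + a) 0 ^ Suc j * c) (at y)" .
    from DERIV_cmult[OF DERIV_cdivide[OF this]]
    have "(?F has_real_derivative (1 + a) *
        (real (Suc (Suc j)) * max (c * y + a) 0 ^ Suc j * c /
          (fact (Suc (Suc j)) * (B * c) * (1 + a) ^ Suc (Suc j)))) (at y)"
      unfolding descent_prob.simps cB c_def[symmetric] .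
    also have "(1 + a) * (real (Suc (Suc j)) * max (c * y + a) 0 ^ Suc j * c /
          (fact (Suc (Suc j)) * (B * c) * (1 + a) ^ Suc (Suc j))) =
        max (c * y + a) 0 ^ Suc j / (fact (Suc j) * B * (1 + a) ^ Suc j)"
      unfolding fact_Suc[of "Suc j"] power_Suc[of "1 + a" "Suc j"]
      using pos a by (simp add: divide_simps del: fact_Suc power_Suc of_nat_Suc)
    also have "\<dots> = descent_prob \<theta> a (Suc j) (\<theta> * y)"
      by (simp add: B_def c_def mult_ac)
    finally show "(?F has_vector_derivative descent_prob \<theta> a (Suc j) (\<theta> * y)) (at y)"
      by (simp only: has_real_derivative_iff_has_vector_derivative)
  next
    show "continuous_on {-a..v} ?F"
      unfolding descent_prob.simps by (intro continuous_intros) (use \<theta> a in auto)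
  qed (use v in auto)
  moreover have "?F (-a) = 0"
    using descent_prob_below[of \<theta> a "-a" "Suc j"] \<theta> a by simp
  ultimately show ?thesis
    by (simp only: Suc diff_zero)
qed

text \<open>Inclusion-exclusion over the initial run of violated inequalities: each run of \<open>i\<close> violations is
  followed by a chain of length \<open>n - i\<close> without a condition on its first entry.\<close>

lemma chain_prob_renewal:
  assumes \<theta>: "0 < \<theta>" "\<theta> \<le> 1" and a: "a > -1" "-\<theta> \<le> a" "a \<le> 0" and "u \<le> 1"
  shows "chain_prob \<theta> a n u =
    (\<Sum>i=0..n. (-1) ^ i * descent_prob \<theta> a i u * chain_prob \<theta> a (n - i) (-a))"
  using \<open>u \<le> 1\<close>
proof (induction n arbitrary: u)
  case 0
  show ?case by simp
next
  case (Suc n)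
  let ?q = "\<lambda>n. chain_prob \<theta> a n (-a)"
  let ?k = "\<lambda>y. chain_prob \<theta> a n (\<theta> * y)"
  define J where "J = (\<lambda>v. \<Sum>i=0..n. (-1) ^ i * descent_prob \<theta> a (Suc i) v * ?q (n - i))"
  have int: "(?k has_integral (1 + a) * J v) {-a..v}" if v: "-a \<le> v" "v \<le> 1" for v
  proof -
    have "((\<lambda>y. \<Sum>i=0..n. (-1) ^ i * ?q (n - i) * descent_prob \<theta> a i (\<theta> * y)) has_integral
        (\<Sum>i=0..n. (-1) ^ i * ?q (n - i) * ((1 + a) * descent_prob \<theta> a (Suc i) v))) {-a..v}"
      by (intro has_integral_sum has_integral_mult_right has_integral_descent_prob)
        (use \<theta> a v in auto)
    moreover have "?k y = (\<Sum>i=0..n. (-1) ^ i * ?q (n - i) * descent_prob \<theta> a i (\<theta> * y))"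
      if "y \<in> {-a..v}" for y
    proof -
      have "\<theta> * y \<le> 1 * 1"
        using that v \<theta> a by (intro mult_mono) auto
      then have "\<theta> * y \<le> 1"
        by simp
      from Suc.IH[OF this] show ?thesis
        by (rule trans) (intro sum.cong refl, simp)
    qed
    moreover have "(\<Sum>i=0..n. (-1) ^ i * ?q (n - i) * ((1 + a) * descent_prob \<theta> a (Suc i) v)) =
        (1 + a) * J v"
      unfolding J_def sum_distrib_left by (rule sum.cong) (simp_all only: mult_ac)
    ultimately show ?thesis
      by (subst has_integral_cong) auto
  qed
  have eq: "chain_prob \<theta> a (Suc n) v = J 1 - J v" if v: "-a \<le> v" "v \<le> 1" for v
  proof -
    have on: "?k integrable_on {-a..1}"
      using has_integral_integrable[OF int[of 1]] a by simp
    have "integral {-a..v} ?k + integral {v..1} ?k = integral {-a..1} ?k"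
      using v by (intro Henstock_Kurzweil_Integration.integral_combine on) auto
    moreover have "integral {-a..1} ?k = (1 + a) * J 1" "integral {-a..v} ?k = (1 + a) * J v"
      by (rule integral_unique[OF int]; use a v in simp)+
    ultimately have "integral {v..1} ?k = (1 + a) * (J 1 - J v)"
      by (simp only: right_diff_distrib eq_diff_eq add.commute)
    then show ?thesis
      using v a by (simp add: max_absorb1)
  qed
  have J_below: "J v = 0" if "v \<le> -a" for v
    unfolding J_def
    using that \<theta> a by (intro sum.neutral) (simp add: descent_prob_below del: descent_prob.simps)
  have "chain_prob \<theta> a (Suc n) u = ?q (Suc n) - J u"
  proof (cases "u \<le> -a")
    case True
    then show ?thesis
      using chain_prob_below[OF True, of \<theta> "Suc n"] J_below[OF True] by simp
  next
    case False
    then have "chain_prob \<theta> a (Suc n) u = J 1 - J u" "?q (Suc n) = J 1 - J (-a)"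
      by (intro eq; use a Suc.prems in simp)+
    then show ?thesis
      using J_below[of "-a"] by simp
  qed
  also have "\<dots> = (\<Sum>i=0..Suc n. (-1) ^ i * descent_prob \<theta> a i u * ?q (Suc n - i))"
    unfolding sum.atLeast0_atMost_Suc_shift J_def
    by (simp add: sum_negf del: descent_prob.simps(2) chain_prob.simps)
  finally show ?case .
qed

text \<open>At level 1 a nonempty chain has probability 0, and the renewal formula becomes a convolution
  equation for the chain probabilities at \<open>-a\<close>.\<close>

lemma chain_prob_series_renewal:
  assumes \<theta>: "0 < \<theta>" "\<theta> \<le> 1" and a: "a > -1" "-\<theta> \<le> a" "a \<le> 0"
  shows "Abs_fps (\<lambda>n. chain_prob \<theta> a (Suc n) (-a)) =
         pos_part_series \<theta> a / (1 - fps_X * pos_part_series \<theta> a)"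
    (is "?S = ?P / _")
proof (rule eq_divideI_mult)
  let ?q = "\<lambda>n. chain_prob \<theta> a n (-a)"
  have P: "fps_nth ?P i = (-1) ^ i * descent_prob \<theta> a (Suc i) 1" for i
    by (simp add: pos_part_series_def)
  have "fps_nth ((1 - fps_X * ?P)) 0 = 1"
    by simp
  then show "1 - fps_X * ?P \<noteq> 0"
    by (metis fps_zero_nth zero_neq_one)
  have "?S = ?P * (1 + fps_X * ?S)"
  proof (rule fps_ext)
    fix n
    have q: "fps_nth (1 + fps_X * ?S) m = ?q m" for m
      by (cases m) simp_all
    have "0 = chain_prob \<theta> a (Suc n) 1"
      by (rule chain_prob_above[symmetric]) simp
    also have "\<dots> = ?q (Suc n) - (\<Sum>i=0..n. (-1) ^ i * descent_prob \<theta> a (Suc i) 1 * ?q (n - i))"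
      unfolding chain_prob_renewal[OF \<theta> a order_refl, of "Suc n"] sum.atLeast0_atMost_Suc_shift
      by (simp add: sum_negf del: descent_prob.simps(2) chain_prob.simps)
    finally have "?q (Suc n) = (\<Sum>i=0..n. (-1) ^ i * descent_prob \<theta> a (Suc i) 1 * ?q (n - i))"
      by simp
    also have "\<dots> = fps_nth (?P * (1 + fps_X * ?S)) n"
      unfolding fps_mult_nth q P ..
    finally show "fps_nth ?S n = fps_nth (?P * (1 + fps_X * ?S)) n"
      by (simp only: fps_nth_Abs_fps)
  qed
  then have "?S * (1 - fps_X * ?P) = ?P * (1 + fps_X * ?S) - ?S * (fps_X * ?P)"
    by (simp only: right_diff_distrib mult_1_right)
  then show "?S * (1 - fps_X * ?P) = ?P"
    by (simp only: distrib_left mult_1_left mult_1_right mult_ac add_diff_cancel_right')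
qed

section \<open>Void inequalities\<close>

text \<open>No entry is below \<open>-a\<close>, and here \<open>\<theta>\<close> times an entry never exceeds \<open>-a\<close>, so all conditions are
  void.\<close>

lemma chain_prob_eq_1:
  assumes a: "a > -1" and \<theta>: "\<theta> \<le> 1" and "a \<le> min (-\<theta>) 0" and "u \<le> -a"
  shows "chain_prob \<theta> a n u = 1"
  using \<open>u \<le> -a\<close>
proof (induction n arbitrary: u)
  case (Suc n)
  have "chain_prob \<theta> a n (\<theta> * y) = 1" if "-a \<le> y" "y \<le> 1" for y
  proof (rule Suc.IH)
    show "\<theta> * y \<le> -a"
    proof (cases "\<theta> \<ge> 0")
      case True
      then have "\<theta> * y \<le> \<theta> * 1"
        using that by (intro mult_left_mono)
      then show ?thesis
        using assms by simp
    next
      case False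
      then have "\<theta> * y \<le> 0"
        using that assms by (intro mult_nonpos_nonneg) auto
      then show ?thesis
        using assms by simp
    qed
  qed
  then have "integral {-a..1} (\<lambda>y. chain_prob \<theta> a n (\<theta> * y)) = integral {-a..1} (\<lambda>y. 1)"
    by (intro integral_cong) simp
  with a Suc.prems show ?case
    by (simp add: max_absorb2)
qed simp

section \<open>The generating functions of the persistence probabilities\<close>

theorem theorem1:
  fixes M :: "'w measure" and X :: "nat \<Rightarrow> 'w \<Rightarrow> real" and a \<theta> :: real
  assumes "a > -1"
    and "prob_space M"
    and "prob_space.indep_vars M (\<lambda>_. borel) X {1..}"
    and "\<And>i. i \<ge> 1 \<Longrightarrow> distr M borel (X i) = uniform_measure lborel {-a..1}"
  shows
    "((0 \<le> \<theta> \<and> \<theta> \<le> 1 \<and> a \<ge> 0) \<or> (-1 \<le> \<theta> \<and> \<theta> < 0 \<and> -\<theta> \<le> a \<and> a \<le> -1/\<theta>) \<longrightarrow>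
       Abs_fps (persistence_prob M X \<theta>) =
         (deformed_exp \<theta> (fps_const (a / (1 + a)) * fps_X)
            - deformed_exp \<theta> (fps_const (-1 / (1 + a)) * fps_X))
         / (fps_X * deformed_exp \<theta> (fps_const (-1 / (1 + a)) * fps_X)))
     \<and>
     (-1 \<le> \<theta> \<and> \<theta> < 0 \<and> a \<ge> -1/\<theta> \<longrightarrow>
       Abs_fps (persistence_prob M X \<theta>) =
         fps_const ((\<theta> * a + 1) / (\<theta> * (1 + a)))
         + (deformed_exp \<theta> (fps_const (-1 / (\<theta> * (1 + a))) * fps_X)
              - deformed_exp \<theta> (fps_const (-1 / (1 + a)) * fps_X))
           / (fps_X * deformed_exp \<theta> (fps_const (-1 / (1 + a)) * fps_X)))
     \<and>
     (-1 \<le> \<theta> \<and> \<theta> < 0 \<and> 0 \<le> a \<and> a \<le> -\<theta> \<longrightarrow>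
       Abs_fps (persistence_prob M X \<theta>) =
         (1 / (deformed_exp \<theta> (fps_const (a / (\<theta> * (1 + a))) * fps_X)
                 / deformed_exp \<theta> (fps_const (a / (1 + a)) * fps_X)
               - fps_const ((1 + a / \<theta>) / (1 + a)) * fps_X)
          - 1) / fps_X)
     \<and>
     (0 < \<theta> \<and> \<theta> \<le> 1 \<and> -\<theta> \<le> a \<and> a \<le> 0 \<longrightarrow>
       Abs_fps (persistence_prob M X \<theta>) =
         pos_part_series \<theta> a / (1 - fps_X * pos_part_series \<theta> a))
     \<and>
     (-1 \<le> \<theta> \<and> \<theta> \<le> 1 \<and> a \<le> min (-\<theta>) 0 \<longrightarrow>
       (\<forall>n. persistence_prob M X \<theta> n = 1))"
proof -
  have p: "persistence_prob M X \<theta> = (\<lambda>n. chain_prob \<theta> a (Suc n) (-a))"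
    using persistence_prob_eq_chain_prob[OF assms] by (rule ext)
  show ?thesis
    unfolding p
    using assms(1) chain_prob_series_stable[OF assms(1) mult_stable_interval[of \<theta> a]]
      chain_prob_series_neg_large[of a \<theta>] chain_prob_series_neg_small[of \<theta> a]
      chain_prob_series_renewal[of \<theta> a] chain_prob_eq_1[of a \<theta> "-a"]
    by blast
qed

end
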